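(* For every integer $n\ge 6$, the $n$-dimensional spined cube $SQ_n$ is isomorphic to the $4$-Cayley graph $\Gamma_n$ of $H\cong\mathbb{Z}_2^{n-2}$ (both graphs as defined in the context).
   Context: All graphs are finite, simple and undirected. The spined cube $SQ_n$ ($n\ge 1$) has as vertices the $2^n$ binary strings $x_1x_2\cdots x_n$ and is defined recursively. $SQ_1$ is the complete graph on the two vertices $0$ and $1$. For $n\ge 2$, $SQ_n$ consists of two copies $0SQ_{n-1}$ and $1SQ_{n-1}$ of $SQ_{n-1}$ (every vertex label prefixed by $0$, respectively by $1$), together with the edges joining each vertex $x=0x_2\cdots x_n$ of $0SQ_{n-1}$ to exactly one vertex $x'$ of $1SQ_{n-1}$, where (all sums of bits are modulo 2): $x'=1x_2$ if $n=2$; $x'=1(x_2+x_n)x_3\cdots x_n$ if $n=3$ or $4$; $x'=1(x_2+x_{n-1})(x_3+x_n)x_4\cdots x_n$ if $n\ge 5$. $m$-Cayley graphs: let $H$ be a group and, for $i,j\in\{1,\dots,m\}$, let $T_{ij}\subseteq H$ satisfy $T_{ij}^{-1}=T_{ji}$ and $1_H\notin T_{ii}$. The $m$-Cayley graph of $H$ relative to the subsets $T_{ij}$ has vertex set $\{h_i : h\in H,\ 1\le i\le m\}$, and $h_i$ is adjacent to $g_j$ if and only if $g=th$ for some $t\in T_{ij}$. The graph $\Gamma_n$ ($n\ge 6$): let $H=\langle a_1\rangle\times\cdots\times\langle a_{n-2}\rangle\cong\mathbb{Z}_2^{n-2}$, and set $T_{11}=\{a_1,a_2,\ldots,a_{n-2}\}$;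 $T_{22}=\{a_ka_{k+2}: 1\le k\le n-4\}\cup\{a_{n-3}a_{n-2}\}$; $T_{33}=\{a_ka_{k+1}a_{k+2}: 1\le k\le n-4\}\cup\{a_{n-3}a_{n-2}\}$; $T_{44}=\{a_ka_{k+1}: 1\le k\le n-4\}\cup\{a_{n-3},a_{n-2}\}$; $T_{12}=T_{14}=T_{34}=\{1_H\}$; $T_{23}=\{1_H,a_{n-2}\}$; $T_{13}=T_{24}=\emptyset$; and $T_{ji}=T_{ij}^{-1}$. Then $\Gamma_n$ is the $4$-Cayley graph of $H$ relative to these $T_{ij}$. *)

theory Defs
  imports
    "HOL-Library.Z2"
    "HOL-Algebra.Elementary_Groups"
    "HOL-Algebra.Product_Groups"
    "HOL-Algebra.Free_Abelian_Groups"
    "Graph_Theory.Pair_Digraph"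
    "Graph_Theory.Digraph_Isomorphism"
begin

text \<open>
  A finite simple undirected graph is a \<^locale>\<open>pair_graph\<close>: an edge joining
  \<open>u\<close> and \<open>v\<close> is represented by the two arcs \<open>(u, v)\<close> and \<open>(v, u)\<close>. For such graphs
  \<^const>\<open>digraph_iso\<close> is the usual notion of graph isomorphism
  (lemma \<open>digraph_iso_iff_bij\<close> below).
\<close>

section \<open>Spined cubes\<close>

text \<open>
  The string \<open>x\<^sub>1 x\<^sub>2 \<dots> x\<^sub>n\<close> is a list of elements of the two-element field
  \<^typ>\<open>bit\<close>, so \<open>+\<close> is addition modulo 2. List positions are counted from 0:
  \<open>x\<^sub>i\<close> is \<open>x ! (i - 1)\<close>, and \<open>x\<^sub>i \<dots> x\<^sub>n\<close> is \<open>drop (i - 1) x\<close>.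
\<close>

definition sq_match :: "nat \<Rightarrow> bit list \<Rightarrow> bit list" where
  "sq_match n x =
    (if n = 2 then [1, x ! 1]
     else if n = 3 \<or> n = 4 then 1 # (x ! 1 + x ! (n - 1)) # drop 2 x
     else 1 # (x ! 1 + x ! (n - 2)) # (x ! 2 + x ! (n - 1)) # drop 3 x)"

text \<open>No value is specified for \<open>n = 0\<close>.\<close>

fun spined_cube :: "nat \<Rightarrow> bit list pair_pre_digraph" where
  "spined_cube (Suc 0) = \<lparr> pverts = {[0], [1]}, parcs = {([0], [1]), ([1], [0])} \<rparr>"
| "spined_cube (Suc (Suc k)) =
    (let G = spined_cube (Suc k);
         M = {(0 # y, sq_match (Suc (Suc k)) (0 # y)) | y. y \<in> pverts G}
     in \<lparr> pverts = {b # y | b y. y \<in> pverts G},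
          parcs = {(b # y, b # z) | b y z. (y, z) \<in> parcs G} \<union> M \<union> M\<inverse> \<rparr>)"


section \<open>\<open>m\<close>-Cayley graphs\<close>

text \<open>The vertex \<open>h\<^sub>i\<close> is the pair \<open>(h, i)\<close>.\<close>

locale mcayley_data = group H for H (structure) +
  fixes m :: nat and T :: "nat \<Rightarrow> nat \<Rightarrow> 'a set"
  assumes T_subset: "\<lbrakk>i \<in> {1..m}; j \<in> {1..m}\<rbrakk> \<Longrightarrow> T i j \<subseteq> carrier H"
    and T_inv: "\<lbrakk>i \<in> {1..m}; j \<in> {1..m}\<rbrakk> \<Longrightarrow> set_inv (T i j) = T j i"
    and T_one: "i \<in> {1..m} \<Longrightarrow> \<one> \<notin> T i i"

definition mcayley_graph ::
    "('a, 'b) monoid_scheme \<Rightarrow> nat \<Rightarrow> (nat \<Rightarrow> nat \<Rightarrow> 'a set) \<Rightarrow> ('a \<times> nat) pair_pre_digraph" where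
  "mcayley_graph H m T =
    \<lparr> pverts = carrier H \<times> {1..m},
      parcs = {((h, i), (g, j)) | h i g j.
        h \<in> carrier H \<and> g \<in> carrier H \<and> i \<in> {1..m} \<and> j \<in> {1..m} \<and>
        (\<exists>t \<in> T i j. g = t \<otimes>\<^bsub>H\<^esub> h)} \<rparr>"


section \<open>The graph \<open>\<Gamma>\<^sub>n\<close>\<close>

text \<open>
  \<open>\<langle>a\<^sub>1\<rangle> \<times> \<dots> \<times> \<langle>a\<^sub>d\<rangle>\<close> is realised as the direct product of \<open>d\<close> copies of \<open>\<int>\<^sub>2\<close>,
  with \<open>a\<^sub>k\<close> the generator of the \<open>k\<close>-th factor.
\<close>

definition elem_group :: "nat \<Rightarrow> (nat \<Rightarrow> int) monoid" where
  "elem_group d = product_group {1..d} (\<lambda>_. integer_mod_group 2)"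

definition elem_gen :: "nat \<Rightarrow> nat \<Rightarrow> (nat \<Rightarrow> int)" where
  "elem_gen d k = (\<lambda>i\<in>{1..d}. if i = k then 1 else 0)"

text \<open>The sets \<open>T\<^sub>i\<^sub>j\<close> with \<open>i \<le> j\<close>.\<close>

definition gamma_upper :: "nat \<Rightarrow> nat \<Rightarrow> nat \<Rightarrow> (nat \<Rightarrow> int) set" where
  "gamma_upper n i j =
    (let H = elem_group (n - 2); a = elem_gen (n - 2) in
     if (i, j) = (1, 1) then {a k | k. k \<in> {1..n - 2}}
     else if (i, j) = (2, 2) then
       {a k \<otimes>\<^bsub>H\<^esub> a (k + 2) | k. k \<in> {1..n - 4}} \<union> {a (n - 3) \<otimes>\<^bsub>H\<^esub> a (n - 2)}
     else if (i, j) = (3, 3) then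
       {a k \<otimes>\<^bsub>H\<^esub> a (k + 1) \<otimes>\<^bsub>H\<^esub> a (k + 2) | k. k \<in> {1..n - 4}} \<union> {a (n - 3) \<otimes>\<^bsub>H\<^esub> a (n - 2)}
     else if (i, j) = (4, 4) then
       {a k \<otimes>\<^bsub>H\<^esub> a (k + 1) | k. k \<in> {1..n - 4}} \<union> {a (n - 3), a (n - 2)}
     else if (i, j) \<in> {(1, 2), (1, 4), (3, 4)} then {\<one>\<^bsub>H\<^esub>}
     else if (i, j) = (2, 3) then {\<one>\<^bsub>H\<^esub>, a (n - 2)}
     else {})"

definition gamma_conn :: "nat \<Rightarrow> nat \<Rightarrow> nat \<Rightarrow> (nat \<Rightarrow> int) set" where
  "gamma_conn n i j =
    (if i \<le> j then gamma_upper n i j else set_inv\<^bsub>elem_group (n - 2)\<^esub> (gamma_upper n j i))"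

definition gamma_graph :: "nat \<Rightarrow> ((nat \<Rightarrow> int) \<times> nat) pair_pre_digraph" where
  "gamma_graph n = mcayley_graph (elem_group (n - 2)) 4 (gamma_conn n)"


section \<open>Well-formedness\<close>

lemma digraph_iso_iff_bij:
  assumes "pair_graph G" "pair_graph G'"
  shows "digraph_iso (with_proj G) (with_proj G') \<longleftrightarrow>
    (\<exists>f. bij_betw f (pverts G) (pverts G') \<and>
      (\<forall>u \<in> pverts G. \<forall>v \<in> pverts G. (u, v) \<in> parcs G \<longleftrightarrow> (f u, f v) \<in> parcs G'))"
    (is "?L \<longleftrightarrow> ?R")
proof
  interpret G: pair_graph G by fact
  interpret G': pair_graph G' by fact
  {
    assume ?L
    then obtain h where h: "pre_digraph.digraph_isomorphism (with_proj G) h"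
      and eq: "with_proj G' = app_iso h (with_proj G)"
      unfolding digraph_iso_def by blast
    let ?f = "iso_verts h"
    have inj: "inj_on ?f (pverts G)" and comm: "\<And>e. e \<in> parcs G \<Longrightarrow>
        ?f (fst e) = iso_tail h (iso_arcs h e) \<and> ?f (snd e) = iso_head h (iso_arcs h e)"
      using h unfolding pre_digraph.digraph_isomorphism_def by auto
    have V: "pverts G' = ?f ` pverts G" and A: "parcs G' = iso_arcs h ` parcs G"
      and t: "iso_tail h = fst" and hd: "iso_head h = snd"
      using arg_cong[OF eq, of verts] arg_cong[OF eq, of arcs]
        arg_cong[OF eq, of tail] arg_cong[OF eq, of head] by simp_all
    have img: "iso_arcs h e = (?f (fst e), ?f (snd e))" if "e \<in> parcs G" for e
      using comm[OF that] unfolding t hd by (simp add: prod_eq_iff)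
    have "(u, v) \<in> parcs G \<longleftrightarrow> (?f u, ?f v) \<in> parcs G'"
      if uv: "u \<in> pverts G" "v \<in> pverts G" for u v
    proof
      assume "(u, v) \<in> parcs G"
      then show "(?f u, ?f v) \<in> parcs G'" using img[of "(u, v)"] A by force
    next
      assume "(?f u, ?f v) \<in> parcs G'"
      then obtain e where e: "e \<in> parcs G" "(?f u, ?f v) = (?f (fst e), ?f (snd e))"
        using A img by auto
      moreover have "fst e \<in> pverts G" "snd e \<in> pverts G"
        using e(1) G.arc_fst_in_verts G.arc_snd_in_verts by auto
      ultimately have "e = (u, v)" using inj uv by (auto simp: prod_eq_iff dest: inj_onD)
      then show "(u, v) \<in> parcs G" using e(1) by simp
    qed
    then show ?R using inj V by (auto simp: bij_betw_def)
  next
    assume ?R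
    then obtain f where inj: "inj_on f (pverts G)" and V: "f ` pverts G = pverts G'"
      and iff: "\<And>u v. u \<in> pverts G \<Longrightarrow> v \<in> pverts G \<Longrightarrow>
        (u, v) \<in> parcs G \<longleftrightarrow> (f u, f v) \<in> parcs G'"
      by (auto simp: bij_betw_def)
    let ?h = "\<lparr> iso_verts = f, iso_arcs = map_prod f f, iso_head = snd, iso_tail = fst \<rparr>"
    have sub: "parcs G \<subseteq> pverts G \<times> pverts G"
      using G.in_arcsD1 G.in_arcsD2 by auto
    have "inj_on (map_prod f f) (parcs G)"
      using map_prod_inj_on[OF inj inj] sub by (rule inj_on_subset)
    then have "pre_digraph.digraph_isomorphism (with_proj G) ?h"
      unfolding pre_digraph.digraph_isomorphism_def
      using inj G.wf_digraph by auto
    moreover have "map_prod f f ` parcs G = parcs G'"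
    proof
      show "map_prod f f ` parcs G \<subseteq> parcs G'" using iff sub by auto
    next
      show "parcs G' \<subseteq> map_prod f f ` parcs G"
      proof
        fix e assume e: "e \<in> parcs G'"
        then have "fst e \<in> f ` pverts G" "snd e \<in> f ` pverts G"
          using V G'.arc_fst_in_verts G'.arc_snd_in_verts by auto
        then obtain u v where "u \<in> pverts G" "v \<in> pverts G" "e = (f u, f v)"
          by (metis imageE prod.collapse)
        then show "e \<in> map_prod f f ` parcs G" using e iff by force
      qed
    qed
    then have "with_proj G' = app_iso ?h (with_proj G)"
      using V by (simp add: app_iso_def with_proj_def)
    ultimately show ?L unfolding digraph_iso_def by blast
  }
qed

lemma pverts_spined_cube: "pverts (spined_cube (Suc k)) = {x. length x = Suc k}"
proof (induction k)
  case 0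
  have "x = [0] \<or> x = [1]" if "length x = Suc 0" for x :: "bit list"
    using that by (cases x) auto
  then show ?case by auto
next
  case (Suc k)
  have "{b # y | b y. length y = Suc k} = {x :: bit list. length x = Suc (Suc k)}"
    by (auto simp: length_Suc_conv)
  then show ?case using Suc by (simp add: Let_def)
qed

lemma length_sq_match: "n \<ge> 2 \<Longrightarrow> length x = n \<Longrightarrow> length (sq_match n x) = n"
  by (auto simp: sq_match_def)

lemma hd_sq_match: "hd (sq_match n x) = 1"
  by (simp add: sq_match_def)

theorem pair_graph_spined_cube:
  assumes "n \<ge> 1"
  shows "pair_graph (spined_cube n)"
proof -
  have "pair_graph (spined_cube (Suc k))" for k
  proof (induction k)
    case 0
    show ?case by unfold_locales (auto simp: symmetric_def sym_def)
  next
    case (Suc k)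
    interpret G: pair_graph "spined_cube (Suc k)" by fact
    let ?G = "spined_cube (Suc k)" and ?G' = "spined_cube (Suc (Suc k))"
    let ?n = "Suc (Suc k)"
    define M where "M = {(0 # y, sq_match ?n (0 # y)) | y. y \<in> pverts ?G}"
    have A: "parcs ?G' = {(b # y, b # z) | b y z. (y, z) \<in> parcs ?G} \<union> M \<union> M\<inverse>"
      by (simp add: M_def Let_def)
    have V: "pverts ?G' = {x. length x = ?n}" by (rule pverts_spined_cube)
    have V0: "pverts ?G = {x. length x = Suc k}" by (rule pverts_spined_cube)
    have MV: "M \<subseteq> pverts ?G' \<times> pverts ?G'"
      unfolding V M_def V0 using length_sq_match[of ?n] by auto
    have AV: "parcs ?G' \<subseteq> pverts ?G' \<times> pverts ?G'"
      using MV G.in_arcsD1[unfolded V0] G.in_arcsD2[unfolded V0] unfolding A V by auto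
    have "UNIV = {0, 1 :: bit}" by (auto intro: bit.exhaust)
    then have "finite (UNIV :: bit set)" by (metis finite.emptyI finite.insertI)
    then have fin: "finite (pverts ?G')"
      unfolding V using finite_lists_length_eq[of "UNIV :: bit set" ?n] by simp
    have symG: "(z, y) \<in> parcs ?G" if "(y, z) \<in> parcs ?G" for y z
      using G.pair_sym_arcs that by (auto simp: symmetric_def dest: symD)
    have symA: "sym (parcs ?G')"
      unfolding A by (rule symI) (auto dest: symG)
    have loopM: "fst e \<noteq> snd e" if "e \<in> M" for e
    proof -
      from that obtain y where "e = (0 # y, sq_match ?n (0 # y))" by (auto simp: M_def)
      then show ?thesis using hd_sq_match[of ?n "0 # y"] by (metis fst_conv snd_conv list.sel(1) zero_neq_one)
    qed
    have loop: "fst e \<noteq> snd e" if "e \<in> parcs ?G'" for e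
      using that unfolding A by (auto dest: loopM G.pair_no_loops)
    show ?case
    proof unfold_locales
      show "finite (parcs ?G')" using AV fin by (meson finite_SigmaI finite_subset)
      show "symmetric (with_proj ?G')" using symA by (simp add: symmetric_def)
    qed (use AV fin loop in \<open>auto simp del: spined_cube.simps\<close>)
  qed
  from this[of "n - 1"] show ?thesis using assms by simp
qed

theorem (in mcayley_data) pair_graph_mcayley_graph:
  assumes "finite (carrier H)"
  shows "pair_graph (mcayley_graph H m T)"
proof -
  let ?G = "mcayley_graph H m T"
  have AV: "parcs ?G \<subseteq> pverts ?G \<times> pverts ?G" by (auto simp: mcayley_graph_def)
  have fin: "finite (pverts ?G)" using assms by (simp add: mcayley_graph_def)
  have symA: "sym (parcs ?G)"
  proof (rule symI)
    fix p q assume "(p, q) \<in> parcs ?G"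
    then obtain h i g j t where *: "p = (h, i)" "q = (g, j)" "h \<in> carrier H" "g \<in> carrier H"
      "i \<in> {1..m}" "j \<in> {1..m}" "t \<in> T i j" "g = t \<otimes> h"
      by (auto simp: mcayley_graph_def)
    then have t: "t \<in> carrier H" using T_subset by blast
    then have "h = inv t \<otimes> g" using * by (simp add: inv_solve_left)
    moreover have "inv t \<in> T j i" using T_inv[of i j] * by (auto simp: SET_INV_def)
    ultimately show "(q, p) \<in> parcs ?G" using * by (auto simp: mcayley_graph_def)
  qed
  have loop: "fst e \<noteq> snd e" if e: "e \<in> parcs ?G" for e
  proof
    assume eq: "fst e = snd e"
    then obtain h i t where *: "h \<in> carrier H" "i \<in> {1..m}" "t \<in> T i i" "h = t \<otimes> h"
      using e by (cases e) (auto simp: mcayley_graph_def)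
    then have "t = \<one>" using T_subset[of i i] by (metis r_cancel_one' subsetD)
    then show False using * T_one by blast
  qed
  show ?thesis
  proof unfold_locales
    show "finite (parcs ?G)" using AV fin by (meson finite_SigmaI finite_subset)
    show "symmetric (with_proj ?G)" using symA by (simp add: symmetric_def)
  qed (use AV fin loop in auto)
qed

lemma group_elem_group: "group (elem_group d)"
  by (simp add: elem_group_def)

lemma carrier_elem_group: "carrier (elem_group d) = {1..d} \<rightarrow>\<^sub>E {0, 1}"
proof -
  have "carrier (integer_mod_group 2) = {0, 1}"
    by (auto simp: carrier_integer_mod_group)
  then show ?thesis by (simp add: elem_group_def)
qed

lemma order_elem_group: "order (elem_group d) = 2 ^ d"
  by (simp add: order_def carrier_elem_group card_PiE numeral_2_eq_2)

lemma mult_elem_group: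
  "x \<otimes>\<^bsub>elem_group d\<^esub> y = (\<lambda>i\<in>{1..d}. (x i + y i) mod 2)"
  by (simp add: elem_group_def mult_integer_mod_group)

lemma one_elem_group: "\<one>\<^bsub>elem_group d\<^esub> = (\<lambda>i\<in>{1..d}. 0)"
  by (simp add: elem_group_def)

lemma elem_gen_closed: "elem_gen d k \<in> carrier (elem_group d)"
  by (auto simp: carrier_elem_group elem_gen_def)

lemma inv_elem_group:
  assumes "x \<in> carrier (elem_group d)"
  shows "inv\<^bsub>elem_group d\<^esub> x = x"
proof -
  have "x \<otimes>\<^bsub>elem_group d\<^esub> x = \<one>\<^bsub>elem_group d\<^esub>"
    unfolding mult_elem_group one_elem_group
    by (rule restrict_ext) (simp flip: mult_2)
  then show ?thesis using assms group.inv_equality[OF group_elem_group] by blast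
qed

lemma set_inv_elem_group:
  "S \<subseteq> carrier (elem_group d) \<Longrightarrow> set_inv\<^bsub>elem_group d\<^esub> S = S"
  using inv_elem_group by (auto simp: SET_INV_def subset_iff)

lemma gamma_upper_subset: "gamma_upper n i j \<subseteq> carrier (elem_group (n - 2))"
proof -
  interpret group "elem_group (n - 2)" by (rule group_elem_group)
  show ?thesis by (auto simp: gamma_upper_def Let_def elem_gen_closed)
qed

lemma gamma_upper_one:
  assumes "n \<ge> 6"
  shows "\<one>\<^bsub>elem_group (n - 2)\<^esub> \<notin> gamma_upper n i i"
proof -
  let ?d = "n - 2" and ?H = "elem_group (n - 2)" and ?a = "elem_gen (n - 2)"
  have neq: "x \<noteq> \<one>\<^bsub>?H\<^esub>" if "k \<in> {1..?d}" "x k = 1" for x k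
    using that by (auto simp: one_elem_group)
  have g1: "?a k \<noteq> \<one>\<^bsub>?H\<^esub>" if "k \<in> {1..?d}" for k
    by (rule neq[OF that]) (use that in \<open>simp add: elem_gen_def\<close>)
  have g2: "?a k \<otimes>\<^bsub>?H\<^esub> ?a l \<noteq> \<one>\<^bsub>?H\<^esub>" if "k \<in> {1..?d}" "k < l" for k l
    by (rule neq[OF that(1)]) (use that in \<open>simp add: elem_gen_def mult_elem_group\<close>)
  have g3: "?a k \<otimes>\<^bsub>?H\<^esub> ?a (k + 1) \<otimes>\<^bsub>?H\<^esub> ?a (k + 2) \<noteq> \<one>\<^bsub>?H\<^esub>" if "k \<in> {1..?d}" for k
    by (rule neq[OF that]) (use that in \<open>simp add: elem_gen_def mult_elem_group\<close>)
  have k: "k \<in> {1..?d}" if "k \<in> {1..n - 4}" for k using that by auto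
  have e: "n - 3 \<in> {1..?d}" "n - 2 \<in> {1..?d}" "n - 3 < n - 2" using assms by auto
  consider "i = 1" | "i = 2" | "i = 3" | "i = 4" | "i \<notin> {1, 2, 3, 4}" by blast
  then show ?thesis
  proof cases
    case 1
    have "\<one>\<^bsub>?H\<^esub> \<noteq> ?a k" if "k \<in> {1..?d}" for k using g1[OF that] by simp
    then show ?thesis unfolding gamma_upper_def Let_def \<open>i = 1\<close> by auto
  next
    case 2
    have "\<one>\<^bsub>?H\<^esub> \<noteq> ?a k \<otimes>\<^bsub>?H\<^esub> ?a (k + 2)" if "k \<in> {1..n - 4}" for k
      using g2[OF k[OF that], of "k + 2"]
      by simp
    moreover have "\<one>\<^bsub>?H\<^esub> \<noteq> ?a (n - 3) \<otimes>\<^bsub>?H\<^esub> ?a (n - 2)"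
      using g2[OF e(1,3)] by simp
    ultimately show ?thesis unfolding gamma_upper_def Let_def \<open>i = 2\<close> by auto
  next
    case 3
    have "\<one>\<^bsub>?H\<^esub> \<noteq> ?a k \<otimes>\<^bsub>?H\<^esub> ?a (k + 1) \<otimes>\<^bsub>?H\<^esub> ?a (k + 2)" if "k \<in> {1..n - 4}" for k
      using g3[OF k[OF that]]
      by simp
    moreover have "\<one>\<^bsub>?H\<^esub> \<noteq> ?a (n - 3) \<otimes>\<^bsub>?H\<^esub> ?a (n - 2)"
      using g2[OF e(1,3)] by simp
    ultimately show ?thesis unfolding gamma_upper_def Let_def \<open>i = 3\<close> by auto
  next
    case 4
    have "\<one>\<^bsub>?H\<^esub> \<noteq> ?a k \<otimes>\<^bsub>?H\<^esub> ?a (k + 1)" if "k \<in> {1..n - 4}" for k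
      using g2[OF k[OF that], of "k + 1"] by simp
    moreover have "\<one>\<^bsub>?H\<^esub> \<noteq> ?a (n - 3)" "\<one>\<^bsub>?H\<^esub> \<noteq> ?a (n - 2)"
      using g1[OF e(1)] g1[OF e(2)] by simp_all
    ultimately show ?thesis unfolding gamma_upper_def Let_def \<open>i = 4\<close> by auto
  next
    case 5
    then show ?thesis by (auto simp: gamma_upper_def Let_def)
  qed
qed

theorem mcayley_data_gamma:
  assumes "n \<ge> 6"
  shows "mcayley_data (elem_group (n - 2)) 4 (gamma_conn n)"
proof -
  interpret group "elem_group (n - 2)" by (rule group_elem_group)
  have c: "gamma_conn n i j = (if i \<le> j then gamma_upper n i j else gamma_upper n j i)" for i j
    by (simp add: gamma_conn_def set_inv_elem_group gamma_upper_subset)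
  show ?thesis
    by unfold_locales
      (use gamma_upper_subset gamma_upper_one[OF assms] in
        \<open>auto simp: c set_inv_elem_group\<close>)
qed

corollary pair_graph_gamma_graph:
  assumes "n \<ge> 6"
  shows "pair_graph (gamma_graph n)"
  unfolding gamma_graph_def
  by (rule mcayley_data.pair_graph_mcayley_graph[OF mcayley_data_gamma[OF assms]])
    (auto simp: carrier_elem_group intro: finite_PiE)

end

theory Submission
  imports Defs
begin

text \<open>
  Write \<open>p = x\<^sub>n\<^sub>-\<^sub>1\<close> and \<open>q = x\<^sub>n\<close> for the last two bits of a vertex \<open>x\<close> of the spined cube, and
  let \<open>e\<^sub>i\<close> be the string whose only 1 is in position \<open>i\<close>. The vertex \<open>x\<close> has one neighbour in
  each dimension \<open>i\<close>, met at the recursion step that prepends bit \<open>i\<close>. Unfolding the recursion,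
  this neighbour is \<open>x\<close> translated by

    \<^item> \<open>e\<^sub>i + p e\<^sub>i\<^sub>+\<^sub>1 + q e\<^sub>i\<^sub>+\<^sub>2\<close> for \<open>i \<le> n - 4\<close>;
    \<^item> \<open>e\<^sub>i + q e\<^sub>i\<^sub>+\<^sub>1\<close> for \<open>i = n - 3\<close> and \<open>i = n - 2\<close>;
    \<^item> \<open>e\<^sub>i\<close> for \<open>i = n - 1\<close> and \<open>i = n\<close>.

  So the translations available at \<open>x\<close> depend only on the two bits \<open>p\<close> and \<open>q\<close>. Adding an element
  of \<open>H = \<int>\<^sub>2\<^sup>n\<^sup>-\<^sup>2\<close> to the first \<open>n - 2\<close> bits is therefore an automorphism. These automorphisms
  have four orbits on the vertices, one for each value of \<open>(p, q)\<close>, which is what makes the cube a 4-Cayley graph. With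
  the orbits \<open>00\<close>, \<open>01\<close>, \<open>11\<close>, \<open>10\<close> numbered \<open>1\<close>, \<open>2\<close>, \<open>3\<close>, \<open>4\<close>, the list above gives exactly the
  sets \<open>T\<^sub>i\<^sub>j\<close> of \<open>\<Gamma>\<^sub>n\<close>. Within an orbit the edges come from the dimensions \<open>i \<le> n - 2\<close>. The last two
  dimensions change \<open>p\<close> or \<open>q\<close> and fix the first \<open>n - 2\<close> bits, which gives the identities in \<open>T\<^sub>i\<^sub>j\<close>.
  The one irregular edge is dimension \<open>n - 2\<close> at \<open>q = 1\<close>: it also flips \<open>p\<close>, so it contributes
  \<open>a\<^sub>n\<^sub>-\<^sub>2\<close> to \<open>T\<^sub>2\<^sub>3\<close> and nothing to \<open>T\<^sub>2\<^sub>2\<close> and \<open>T\<^sub>3\<^sub>3\<close>.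

  Over \<open>\<int>\<^sub>2\<close> a translation is the same as the set of positions that it flips, and both edge
  relations are stated below in terms of that set: \<open>spined_cube_arcs\<close> for the cube and
  \<open>gamma_arcs\<close> for \<open>\<Gamma>\<^sub>n\<close>. Lemma \<open>spine_iff_conn_supports\<close> compares the two families of sets, and
  \<open>bij_betw_cube_to_gamma\<close> says that splitting off the last two bits is a bijection on vertices.
\<close>

section \<open>Edges of the spined cube as sets of flipped bits\<close>

text \<open>Positions are numbered from 1, as in \<open>x\<^sub>1 \<dots> x\<^sub>n\<close>; prepending a bit shifts them by \<open>Suc\<close>.\<close>

definition diff_set :: "bit list \<Rightarrow> bit list \<Rightarrow> nat set" where
  "diff_set x y = {k \<in> {1..length x}. x ! (k - 1) \<noteq> y ! (k - 1)}"

lemma diff_set_Nil [simp]: "diff_set [] [] = {}"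
  by (simp add: diff_set_def)

lemma diff_set_Cons [simp]:
  "diff_set (b # x) (c # y) = (if b = c then {} else {1}) \<union> Suc ` diff_set x y"
proof (rule Set.set_eqI)
  fix k
  show "k \<in> diff_set (b # x) (c # y) \<longleftrightarrow> k \<in> (if b = c then {} else {1}) \<union> Suc ` diff_set x y"
    by (cases k; cases "k - 1") (auto simp: diff_set_def image_iff nth_Cons')
qed

lemma diff_set_self [simp]: "diff_set x x = {}"
  by (simp add: diff_set_def)

lemma diff_set_commute: "length x = length y \<Longrightarrow> diff_set x y = diff_set y x"
  by (auto simp: diff_set_def)

text \<open>
  A bit is determined by whether it differs from a given bit.
\<close>

lemma diff_set_inj:
  assumes "length y = length x" "length z = length x" "diff_set x y = diff_set x z"
  shows "y = z"
proof (rule nth_equalityI)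
  fix k assume k: "k < length y"
  have "Suc k \<in> diff_set x y \<longleftrightarrow> Suc k \<in> diff_set x z" using assms by simp
  then have "x ! k = y ! k \<longleftrightarrow> x ! k = z ! k" using k assms by (simp add: diff_set_def)
  then show "y ! k = z ! k" by (cases "x ! k"; cases "y ! k"; cases "z ! k") auto
qed (use assms in simp)

text \<open>
  The positions flipped on the way from \<open>x\<close> to its neighbour in dimension \<open>i\<close>. That edge
  belongs to a spined cube on the suffix \<open>x\<^sub>i \<dots> x\<^sub>n\<close> of length \<open>n - i + 1\<close>, so \<open>i + 4 \<le> n\<close> is the
  case of length at least 5, and \<open>i + 3 = n\<close>, \<open>i + 2 = n\<close> are the lengths 4 and 3.
\<close>

definition spine :: "bit list \<Rightarrow> nat \<Rightarrow> nat set" where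
  "spine x i = (let n = length x; p = x ! (n - 2); q = x ! (n - 1) in
     {i} \<union> (if i + 4 \<le> n \<and> p = 1 then {i + 1} else {})
         \<union> (if i + 4 \<le> n \<and> q = 1 then {i + 2} else {})
         \<union> (if (i + 3 = n \<or> i + 2 = n) \<and> q = 1 then {i + 1} else {}))"

text \<open>
  The shape of \<^const>\<open>spine\<close> depends only on the distance from \<open>i\<close> to the end of the string
  and on the last two bits. For a one-bit \<open>x\<close> the bit called \<open>p\<close> does change when \<open>b\<close> is prepended,
  but \<open>i + 4 \<le> n\<close> then fails.
\<close>

lemma spine_Cons:
  assumes "x \<noteq> []"
  shows "spine (b # x) (Suc i) = Suc ` spine x i"
proof (cases "length x = 1")
  case True
  then show ?thesis using assms by (simp add: spine_def)
next
  case False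
  then obtain m where m: "length x = Suc (Suc m)"
    using assms by (metis One_nat_def length_0_conv not0_implies_Suc)
  then show ?thesis by (auto simp: spine_def Let_def)
qed

text \<open>
  The neighbour relation is an involution in each dimension: an edge leaves unchanged each of
  the last two bits on which its own shape depends. An edge in dimension \<open>i\<close> with
  \<open>i + 4 \<le> n\<close> reaches at most to position \<open>n - 2\<close>, and one with \<open>i + 2 \<le> n\<close> at most to \<open>n - 1\<close>.
\<close>

lemma spine_of_neighbour:
  assumes "length x = length y" "diff_set x y = spine x i"
  shows "spine y i = spine x i"
proof -
  let ?n = "length x"
  have q: "y ! (?n - 1) = x ! (?n - 1)" if "i + 2 \<le> ?n"
  proof -
    have "?n \<notin> diff_set x y" unfolding assms(2) using that by (simp add: spine_def Let_def)
    then show ?thesis using that by (simp add: diff_set_def)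
  qed
  have p: "y ! (?n - 2) = x ! (?n - 2)" if "i + 4 \<le> ?n"
  proof -
    have "?n - 1 \<notin> diff_set x y" unfolding assms(2) using that by (auto simp: spine_def Let_def)
    moreover have "?n - 1 - 1 = ?n - 2" by simp
    ultimately show ?thesis using that by (simp add: diff_set_def del: diff_diff_left)
  qed
  have "i + 4 \<le> ?n \<and> y ! (?n - 2) = 1 \<longleftrightarrow> i + 4 \<le> ?n \<and> x ! (?n - 2) = 1" using p by metis
  moreover have "i + 4 \<le> ?n \<and> y ! (?n - 1) = 1 \<longleftrightarrow> i + 4 \<le> ?n \<and> x ! (?n - 1) = 1"
    "(i + 3 = ?n \<or> i + 2 = ?n) \<and> y ! (?n - 1) = 1 \<longleftrightarrow> (i + 3 = ?n \<or> i + 2 = ?n) \<and> x ! (?n - 1) = 1"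
    using q by fastforce+
  ultimately show ?thesis unfolding spine_def Let_def assms(1)[symmetric] by (simp only:)
qed

lemma bit_add_eq_iff [simp]: "(a :: bit) = a + b \<longleftrightarrow> b = 0"
  by (cases a; cases b) auto

lemma diff_set_sq_match:
  assumes "length y = Suc k"
  shows "diff_set (0 # y) (sq_match (Suc (Suc k)) (0 # y)) = spine (0 # y) 1"
proof -
  consider "k = 0" | "k = 1" | "k = 2" | m where "k = Suc (Suc (Suc m))"
    by (metis One_nat_def Suc_1 not0_implies_Suc)
  then show ?thesis
  proof cases
    case 1
    then obtain c where "y = [c]" using assms by (auto simp: length_Suc_conv)
    with 1 show ?thesis by (simp add: sq_match_def spine_def)
  next
    case 2
    then obtain c d where "y = [c, d]" using assms by (auto simp: length_Suc_conv)
    with 2 show ?thesis by (cases d) (simp_all add: sq_match_def spine_def)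
  next
    case 3
    then obtain c d e where "y = [c, d, e]" using assms
      by (auto simp: length_Suc_conv numeral_2_eq_2)
    with 3 show ?thesis by (cases e) (simp_all add: sq_match_def spine_def)
  next
    case 4
    then obtain c d r where y: "y = c # d # r" and r: "length r = Suc (Suc m)"
      using assms by (auto simp: length_Suc_conv)
    show ?thesis using 4 r
      by (auto simp: y sq_match_def spine_def Let_def)
  qed
qed

text \<open>
  The recursion for the cube splits off the first bit. Edges inside the two copies are those
  of dimension \<open>i \<ge> 2\<close>, by \<open>spine_Cons\<close>. The matching and its converse are together the edges of
  dimension 1: the matching is their orientation away from the copy with first bit 0, and
  \<open>spine_of_neighbour\<close> supplies the other orientation.
\<close>

lemma spined_cube_arcs:
  "(x, y) \<in> parcs (spined_cube (Suc k)) \<longleftrightarrow>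
     length x = Suc k \<and> length y = Suc k \<and> (\<exists>i \<in> {1..Suc k}. diff_set x y = spine x i)"
proof (induction k arbitrary: x y)
  case 0
  have "(x = [0] \<and> y = [1] \<or> x = [1] \<and> y = [0]) \<longleftrightarrow>
    length x = 1 \<and> length y = 1 \<and> diff_set x y = {1}"
  proof (cases "length x = 1 \<and> length y = 1")
    case True
    then obtain b c where "x = [b]" "y = [c]" by (auto simp: length_Suc_conv)
    then show ?thesis by (cases b; cases c) simp_all
  qed auto
  moreover have "(x, y) \<in> parcs (spined_cube (Suc 0)) \<longleftrightarrow>
    (x = [0] \<and> y = [1] \<or> x = [1] \<and> y = [0])" by auto
  moreover have "spine x 1 = {1}" if "length x = 1" using that by (simp add: spine_def)
  ultimately show ?case by (simp cong: conj_cong del: spined_cube.simps)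
next
  case (Suc k)
  let ?n = "Suc (Suc k)"
  define M where "M = {(0 # u, sq_match ?n (0 # u)) | u. length u = Suc k}"
  have A: "parcs (spined_cube ?n) =
      {(b # u, b # v) | b u v. (u, v) \<in> parcs (spined_cube (Suc k))} \<union> M \<union> M\<inverse>"
    by (simp add: M_def Let_def pverts_spined_cube)
  show ?case
  proof (cases "length x = ?n \<and> length y = ?n")
    case False
    have "length u = ?n \<and> length v = ?n" if "(u, v) \<in> M" for u v
      using that length_sq_match[of ?n] by (auto simp: M_def)
    with False show ?thesis unfolding A by (auto simp: Suc)
  next
    case True
    then obtain b u c v where x: "x = b # u" and y: "y = c # v"
      and u: "length u = Suc k" and v: "length v = Suc k"
      by (auto simp: length_Suc_conv)
    have inner: "(\<exists>i \<in> {2..?n}. diff_set x y = spine x i) \<longleftrightarrow>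
        b = c \<and> (u, v) \<in> parcs (spined_cube (Suc k))"
    proof -
      have step: "diff_set x y = spine x (Suc i) \<longleftrightarrow> b = c \<and> diff_set u v = spine u i"
        if "i \<in> {1..Suc k}" for i
      proof -
        have "spine x (Suc i) = Suc ` spine u i"
          unfolding x by (rule spine_Cons) (use u in auto)
        moreover have "1 \<notin> Suc ` spine u i" using that by (auto simp: spine_def Let_def)
        ultimately show ?thesis
          by (cases "b = c") (auto simp: x y inj_image_eq_iff simp del: One_nat_def)
      qed
      have "{2..?n} = Suc ` {1..Suc k}" by (simp add: numeral_2_eq_2)
      then have "(\<exists>i \<in> {2..?n}. diff_set x y = spine x i) \<longleftrightarrow>
          (\<exists>i \<in> {1..Suc k}. diff_set x y = spine x (Suc i))" by (simp only: bex_simps)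
      also have "\<dots> \<longleftrightarrow> b = c \<and> (\<exists>i \<in> {1..Suc k}. diff_set u v = spine u i)"
        using step by blast
      finally show ?thesis using u v by (simp only: Suc) simp
    qed
    have M: "(w, z) \<in> M \<longleftrightarrow> hd w = 0 \<and> diff_set w z = spine w 1"
      if "length w = ?n" "length z = ?n" for w z
    proof -
      obtain a t where w: "w = a # t" "length t = Suc k" using \<open>length w = ?n\<close>
        by (auto simp: length_Suc_conv)
      have "z = sq_match ?n w \<longleftrightarrow> diff_set w z = spine w 1" if "a = 0"
        using diff_set_inj[of z w "sq_match ?n w"] diff_set_sq_match[of t k]
          \<open>length w = ?n\<close> \<open>length z = ?n\<close> length_sq_match[of ?n w] that w by auto
      then show ?thesis using w by (auto simp: M_def)
    qed
    have rev: "diff_set y x = spine y 1 \<longleftrightarrow> diff_set x y = spine x 1"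
      using spine_of_neighbour[of x y 1] spine_of_neighbour[of y x 1] diff_set_commute[of x y] True
      by auto
    have hd: "hd x = 0 \<or> hd y = 0" if "diff_set x y = spine x 1"
    proof -
      have "1 \<in> diff_set x y" using that by (simp add: spine_def Let_def)
      then show ?thesis
        by (cases b; cases c) (auto simp: x y diff_set_def simp del: diff_set_Cons)
    qed
    have outer: "(x, y) \<in> M \<union> M\<inverse> \<longleftrightarrow> diff_set x y = spine x 1"
    proof -
      have "(x, y) \<in> M \<longleftrightarrow> hd x = 0 \<and> diff_set x y = spine x 1"
        "(y, x) \<in> M \<longleftrightarrow> hd y = 0 \<and> diff_set x y = spine x 1"
        using M[of x y] M[of y x] True by (simp_all only: rev)
      then show ?thesis using hd by blast
    qed
    have "{1..?n} = insert 1 {2..?n}" by auto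
    then show ?thesis using inner outer True unfolding A by (auto simp: x y)
  qed
qed

section \<open>Subsets as coordinates on the elementary abelian group\<close>

definition elem_vec :: "nat \<Rightarrow> nat set \<Rightarrow> nat \<Rightarrow> int" where
  "elem_vec d S = (\<lambda>k\<in>{1..d}. of_bool (k \<in> S))"

lemma elem_vec_closed: "elem_vec d S \<in> carrier (elem_group d)"
  by (auto simp: elem_vec_def carrier_elem_group)

lemma elem_vec_eq_iff: "elem_vec d S = elem_vec d S' \<longleftrightarrow> S \<inter> {1..d} = S' \<inter> {1..d}"
proof
  assume eq: "elem_vec d S = elem_vec d S'"
  have "k \<in> S \<longleftrightarrow> k \<in> S'" if "k \<in> {1..d}" for k
    using fun_cong[OF eq, of k] that by (simp add: elem_vec_def of_bool_def split: if_splits)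
  then show "S \<inter> {1..d} = S' \<inter> {1..d}" by blast
next
  assume eq: "S \<inter> {1..d} = S' \<inter> {1..d}"
  have "k \<in> S \<longleftrightarrow> k \<in> S'" if "k \<in> {1..d}" for k using eq that by blast
  then show "elem_vec d S = elem_vec d S'" unfolding elem_vec_def by (intro restrict_ext) simp
qed

lemma elem_vec_mult:
  "elem_vec d S \<otimes>\<^bsub>elem_group d\<^esub> elem_vec d S' = elem_vec d (sym_diff S S')"
  unfolding mult_elem_group elem_vec_def by (rule restrict_ext) auto

lemma elem_gen_eq_elem_vec: "elem_gen d k = elem_vec d {k}"
  unfolding elem_gen_def elem_vec_def by (rule restrict_ext) auto

lemma one_eq_elem_vec: "\<one>\<^bsub>elem_group d\<^esub> = elem_vec d {}"
  unfolding one_elem_group elem_vec_def by (rule restrict_ext) auto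

section \<open>The connection sets of the 4-Cayley graph\<close>

text \<open>
  The sets of generators whose products form \<open>T\<^sub>i\<^sub>j\<close>. Every element of \<open>H\<close> is its own inverse,
  so \<open>T\<^sub>i\<^sub>j = T\<^sub>j\<^sub>i\<close> and the off-diagonal cases may be indexed by unordered pairs.
\<close>

definition conn_supports :: "nat \<Rightarrow> nat \<Rightarrow> nat \<Rightarrow> nat set set" where
  "conn_supports n i j =
    (if (i, j) = (1, 1) then (\<lambda>k. {k}) ` {1..n - 2}
     else if (i, j) = (2, 2) then insert {n - 3, n - 2} ((\<lambda>k. {k, k + 2}) ` {1..n - 4})
     else if (i, j) = (3, 3) then insert {n - 3, n - 2} ((\<lambda>k. {k, k + 1, k + 2}) ` {1..n - 4})
     else if (i, j) = (4, 4) then {{n - 3}, {n - 2}} \<union> (\<lambda>k. {k, k + 1}) ` {1..n - 4}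
     else if {i, j} \<in> {{1, 2}, {1, 4}, {3, 4}} then {{}}
     else if {i, j} = {2, 3} then {{}, {n - 2}}
     else {})"

lemma gamma_conn_commute: "gamma_conn n i j = gamma_conn n j i"
  by (cases i j rule: linorder_cases)
    (simp_all add: gamma_conn_def set_inv_elem_group gamma_upper_subset)

lemma conn_supports_commute: "conn_supports n i j = conn_supports n j i"
  by (auto simp: conn_supports_def insert_commute)

lemma conn_supports_subset:
  assumes "n \<ge> 6"
  shows "\<Union> (conn_supports n i j) \<subseteq> {1..n - 2}"
proof -
  have if_Union: "\<Union> (if c then A else B) \<subseteq> R" if "\<Union> A \<subseteq> R" "\<Union> B \<subseteq> R"
    for c R and A B :: "nat set set"
    using that by simp
  have branches: "\<Union> ((\<lambda>k. {k}) ` {1..n - 2}) \<subseteq> {1..n - 2}"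
    "\<Union> (insert {n - 3, n - 2} ((\<lambda>k. {k, k + 2}) ` {1..n - 4})) \<subseteq> {1..n - 2}"
    "\<Union> (insert {n - 3, n - 2} ((\<lambda>k. {k, k + 1, k + 2}) ` {1..n - 4})) \<subseteq> {1..n - 2}"
    "\<Union> ({{n - 3}, {n - 2}} \<union> (\<lambda>k. {k, k + 1}) ` {1..n - 4}) \<subseteq> {1..n - 2}"
    "\<Union> {{}} \<subseteq> {1..n - 2}" "\<Union> {{}, {n - 2}} \<subseteq> {1..n - 2}" "\<Union> {} \<subseteq> {1..n - 2}"
    using assms by auto
  show ?thesis
    unfolding conn_supports_def by (intro if_Union branches)
qed

lemma gamma_conn_eq:
  assumes "n \<ge> 6" "i \<in> {1..4}" "j \<in> {1..4}"
  shows "gamma_conn n i j = elem_vec (n - 2) ` conn_supports n i j"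
proof -
  have sd: "sym_diff {k} {k + 2} = {k, k + 2}" "sym_diff {k} {k + 1} = {k, k + 1}"
    "sym_diff {k, k + 1} {k + 2} = {k, k + 1, k + 2}"
    "sym_diff {n - 3} {n - 2} = {n - 3, n - 2}" for k :: nat
    using assms(1) by auto
  have upper: "gamma_conn n i j = elem_vec (n - 2) ` conn_supports n i j"
    if "i \<le> j" "i \<in> {1, 2, 3, 4}" "j \<in> {1, 2, 3, 4}" for i j
    using that unfolding gamma_conn_def gamma_upper_def Let_def
      elem_gen_eq_elem_vec elem_vec_mult one_eq_elem_vec sd
    by (elim insertE emptyE)
      (simp_all add: conn_supports_def doubleton_eq_iff Setcompr_eq_image image_image
        del: atLeastAtMost_iff)
  have "{1..4} = {1, 2, 3, 4 :: nat}" by auto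
  then show ?thesis
    using upper[of i j] upper[of j i] assms(2,3) gamma_conn_commute conn_supports_commute
    by (metis nle_le)
qed

text \<open>
  The number of the orbit of \<open>x\<close> under translation of its first \<open>n - 2\<close> bits. Cyclically
  consecutive numbers belong to pairs \<open>(p, q)\<close> that differ in one bit; the edges between orbits
  need this, because no edge changes both \<open>p\<close> and \<open>q\<close> and \<open>T\<^sub>1\<^sub>3\<close>, \<open>T\<^sub>2\<^sub>4\<close> are empty.
\<close>

definition last_bits_class :: "bit list \<Rightarrow> nat" where
  "last_bits_class x =
    (let p = x ! (length x - 2); q = x ! (length x - 1)
     in if q = 0 then (if p = 0 then 1 else 4) else (if p = 0 then 2 else 3))"

text \<open>
  The connection sets are read off from the edges of the cube. The flipped positions are
  separated into those among the first \<open>n - 2\<close> bits, which form the translation by an element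
  of \<open>H\<close>, and the last two, which say to which orbit the edge leads. It then suffices to compare, for
  each of the 16 pairs of orbits, the translations that lead from one to the other.
\<close>

lemma spine_iff_conn_supports:
  assumes "n \<ge> 6" "length x = n" "length y = n"
  shows "(\<exists>i \<in> {1..n}. diff_set x y = spine x i) \<longleftrightarrow>
    diff_set x y \<inter> {1..n - 2} \<in> conn_supports n (last_bits_class x) (last_bits_class y)"
proof -
  define D where "D = diff_set x y \<inter> {1..n - 2}"
  define p q p' q' where pq: "p = x ! (n - 2)" "q = x ! (n - 1)"
    "p' = y ! (n - 2)" "q' = y ! (n - 1)"
  have mem: "n - 1 \<in> diff_set x y \<longleftrightarrow> p \<noteq> p'" "n \<in> diff_set x y \<longleftrightarrow> q \<noteq> q'"
    using assms by (auto simp: diff_set_def pq numeral_2_eq_2)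
  have split_range: "{1..n} = insert (n - 1) (insert n {1..n - 2})" using assms by auto
  have eq: "diff_set x y = S \<longleftrightarrow>
      D = S \<inter> {1..n - 2} \<and> (p \<noteq> p' \<longleftrightarrow> n - 1 \<in> S) \<and> (q \<noteq> q' \<longleftrightarrow> n \<in> S)"
    if "S \<subseteq> {1..n}" for S
  proof -
    have "diff_set x y \<subseteq> {1..n}" using assms by (auto simp: diff_set_def)
    then show ?thesis using that unfolding D_def split_range mem[symmetric] by blast
  qed
  have sub: "spine x i \<subseteq> {1..n}" if "i \<in> {1..n}" for i
    using that assms by (auto simp: spine_def Let_def)
  have low: "diff_set x y = spine x i \<longleftrightarrow> D = {i} \<union> (if p = 1 then {i + 1} else {})
      \<union> (if q = 1 then {i + 2} else {}) \<and> p = p' \<and> q = q'" if "i \<in> {1..n - 4}" for i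
  proof -
    have "spine x i = {i} \<union> (if p = 1 then {i + 1} else {}) \<union> (if q = 1 then {i + 2} else {})"
      using that assms by (auto simp: spine_def Let_def pq)
    moreover have "spine x i \<inter> {1..n - 2} = spine x i" "n - 1 \<notin> spine x i" "n \<notin> spine x i"
      using that assms by (auto simp: spine_def Let_def)
    moreover have "i \<in> {1..n}" using that by auto
    ultimately show ?thesis using eq[OF sub[of i]] by simp
  qed
  \<comment> \<open>Substituting \<open>n = m + 6\<close> leaves no truncated subtraction in the four special dimensions.\<close>
  obtain m where m: "n = m + 6" using assms(1) by (metis le_Suc_ex add.commute)
  have m_diff: "n - 1 = m + 5" "n - 2 = m + 4" "n - 3 = m + 3" using m by simp_all
  have s3: "spine x (n - 3) = {n - 3} \<union> (if q = 1 then {n - 2} else {})"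
    and s2: "spine x (n - 2) = {n - 2} \<union> (if q = 1 then {n - 1} else {})"
    and s1: "spine x (n - 1) = {n - 1}" and s0: "spine x n = {n}"
    using assms(2) m by (simp_all add: spine_def Let_def pq eval_nat_numeral)
  have n3: "diff_set x y = spine x (n - 3) \<longleftrightarrow>
      D = {n - 3} \<union> (if q = 1 then {n - 2} else {}) \<and> p = p' \<and> q = q'"
    using eq[OF sub[of "n - 3"]]
    unfolding s3 unfolding m_diff unfolding m by (cases q) simp_all
  have n2: "diff_set x y = spine x (n - 2) \<longleftrightarrow> D = {n - 2} \<and> (p \<noteq> p' \<longleftrightarrow> q = 1) \<and> q = q'"
    using eq[OF sub[of "n - 2"]]
    unfolding s2 unfolding m_diff unfolding m by (cases q) simp_all
  have n1: "diff_set x y = spine x (n - 1) \<longleftrightarrow> D = {} \<and> p \<noteq> p' \<and> q = q'"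
    using eq[OF sub[of "n - 1"]]
    unfolding s1 unfolding m_diff unfolding m by (cases q) simp_all
  have n0: "diff_set x y = spine x n \<longleftrightarrow> D = {} \<and> p = p' \<and> q \<noteq> q'"
    using eq[OF sub[of n]]
    unfolding s0 unfolding m_diff unfolding m by (cases q) simp_all
  have index_split: "{1..n} = {1..n - 4} \<union> {n - 3, n - 2, n - 1, n}"
    "{1..n - 2} = {1..n - 4} \<union> {n - 3, n - 2}" using assms by auto
  have L: "(\<exists>i \<in> {1..n}. diff_set x y = spine x i) \<longleftrightarrow>
      (\<exists>i \<in> {1..n - 4}. D = {i} \<union> (if p = 1 then {i + 1} else {})
        \<union> (if q = 1 then {i + 2} else {}) \<and> p = p' \<and> q = q') \<or>
      (D = {n - 3} \<union> (if q = 1 then {n - 2} else {}) \<and> p = p' \<and> q = q') \<or>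
      (D = {n - 2} \<and> (p \<noteq> p' \<longleftrightarrow> q = 1) \<and> q = q') \<or>
      (D = {} \<and> p \<noteq> p' \<and> q = q') \<or> (D = {} \<and> p = p' \<and> q \<noteq> q')"
    unfolding index_split(1) bex_Un using low n3 n2 n1 n0 by simp
  show ?thesis
    unfolding L D_def[symmetric] last_bits_class_def assms pq[symmetric] Let_def
    unfolding conn_supports_def index_split(2)
    by (cases p; cases q; cases p'; cases q')
      (simp_all add: image_iff doubleton_eq_iff insert_commute disj_ac del: atLeastAtMost_iff)
qed

section \<open>The isomorphism\<close>

definition ones :: "bit list \<Rightarrow> nat set" where
  "ones x = {k \<in> {1..length x}. x ! (k - 1) = 1}"

text \<open>
  The set of ones still contains \<open>n - 1\<close> or \<open>n\<close> when the last two bits are set, but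
  \<^const>\<open>elem_vec\<close> of dimension \<open>n - 2\<close> ignores these positions.
\<close>

definition cube_to_gamma :: "bit list \<Rightarrow> (nat \<Rightarrow> int) \<times> nat" where
  "cube_to_gamma x = (elem_vec (length x - 2) (ones x), last_bits_class x)"

lemma diff_set_eq_sym_diff_ones:
  "length x = length y \<Longrightarrow> diff_set x y = sym_diff (ones x) (ones y)"
  by (auto simp: diff_set_def ones_def)

lemma bij_betw_cube_to_gamma:
  assumes "n \<ge> 6"
  shows "bij_betw cube_to_gamma {x. length x = n} (carrier (elem_group (n - 2)) \<times> {1..4})"
    (is "bij_betw _ ?V ?W")
proof -
  have inj: "inj_on cube_to_gamma ?V"
  proof (rule inj_onI)
    fix x y assume len: "x \<in> ?V" "y \<in> ?V" and eq: "cube_to_gamma x = cube_to_gamma y"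
    have "ones x \<inter> {1..n - 2} = ones y \<inter> {1..n - 2}"
      using eq len by (simp add: cube_to_gamma_def elem_vec_eq_iff)
    then have D: "diff_set x y \<inter> {1..n - 2} = {}"
      using len by (auto simp: diff_set_eq_sym_diff_ones)
    have "x ! (n - 2) = y ! (n - 2)" "x ! (n - 1) = y ! (n - 1)"
      using eq len
      by (cases "x ! (n - 2)"; cases "x ! (n - 1)"; cases "y ! (n - 2)"; cases "y ! (n - 1)";
          simp add: cube_to_gamma_def last_bits_class_def Let_def)+
    then have "n - 1 \<notin> diff_set x y" "n \<notin> diff_set x y"
      by (auto simp: diff_set_def numeral_2_eq_2)
    moreover have "{1..n} = {1..n - 2} \<union> {n - 1, n}" using assms by auto
    moreover have "diff_set x y \<subseteq> {1..n}" using len by (auto simp: diff_set_def)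
    ultimately have "diff_set x y = diff_set x x" using D by auto
    then show "x = y" using diff_set_inj len by blast
  qed
  have sub: "cube_to_gamma ` ?V \<subseteq> ?W"
    by (auto simp: cube_to_gamma_def elem_vec_closed last_bits_class_def Let_def)
  have bits: "(UNIV :: bit set) = {0, 1}" by (auto intro: bit.exhaust)
  have card_bit: "card (UNIV :: bit set) = 2" unfolding bits by simp
  have finite_bit: "finite (UNIV :: bit set)" unfolding bits by simp
  have "n = n - 2 + 2" using assms by simp
  then have pow: "2 ^ n = 2 ^ (n - 2) * (2 ^ 2 :: nat)" by (metis power_add)
  have "card ?V = 2 ^ n"
    using card_lists_length_eq[of "UNIV :: bit set" n] card_bit finite_bit by simp
  also note pow
  also have "2 ^ (n - 2) * 2 ^ 2 = card ?W"
    using order_elem_group[of "n - 2"] by (simp add: order_def card_cartesian_product)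
  finally have "card (cube_to_gamma ` ?V) = card ?W" by (simp add: card_image inj)
  moreover have "finite ?W" by (auto simp: carrier_elem_group intro: finite_PiE)
  ultimately have "cube_to_gamma ` ?V = ?W" using sub by (intro card_subset_eq)
  then show ?thesis using inj by (simp add: bij_betw_def)
qed

text \<open>
  In the coordinates of \<^const>\<open>elem_vec\<close>, the group element taking one vertex to the other is the
  symmetric difference of the sets of ones, that is, the set of flipped bits.
\<close>

lemma gamma_arcs:
  assumes "n \<ge> 6" "length x = n" "length y = n"
  shows "(cube_to_gamma x, cube_to_gamma y) \<in> parcs (gamma_graph n) \<longleftrightarrow>
    diff_set x y \<inter> {1..n - 2} \<in> conn_supports n (last_bits_class x) (last_bits_class y)"
proof -
  let ?i = "last_bits_class x" and ?j = "last_bits_class y"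
  have ij: "?i \<in> {1..4}" "?j \<in> {1..4}" by (auto simp: last_bits_class_def Let_def)
  have sub: "S \<subseteq> {1..n - 2}" if "S \<in> conn_supports n ?i ?j" for S
    using that conn_supports_subset[OF assms(1)] by blast
  have "elem_vec (n - 2) (ones y) =
      elem_vec (n - 2) S \<otimes>\<^bsub>elem_group (n - 2)\<^esub> elem_vec (n - 2) (ones x)
      \<longleftrightarrow> diff_set x y \<inter> {1..n - 2} = S" if "S \<subseteq> {1..n - 2}" for S
    using that assms(2,3) unfolding elem_vec_mult elem_vec_eq_iff
    by (subst diff_set_eq_sym_diff_ones) auto
  then have "(\<exists>t \<in> gamma_conn n ?i ?j. elem_vec (n - 2) (ones y) =
        t \<otimes>\<^bsub>elem_group (n - 2)\<^esub> elem_vec (n - 2) (ones x))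
      \<longleftrightarrow> diff_set x y \<inter> {1..n - 2} \<in> conn_supports n ?i ?j"
    using sub unfolding gamma_conn_eq[OF assms(1) ij] by auto
  then show ?thesis
    using ij assms(2,3)
    by (simp add: gamma_graph_def mcayley_graph_def cube_to_gamma_def elem_vec_closed)
qed

theorem lemma3p4:
  fixes n :: nat
  assumes "n \<ge> 6"
  shows "digraph_iso (with_proj (spined_cube n)) (with_proj (gamma_graph n))"
proof -
  obtain k where k: "n = Suc k" using assms by (cases n) auto
  have V: "pverts (spined_cube n) = {x. length x = n}"
    unfolding k by (rule pverts_spined_cube)
  have W: "pverts (gamma_graph n) = carrier (elem_group (n - 2)) \<times> {1..4}"
    by (simp add: gamma_graph_def mcayley_graph_def)
  have arcs: "(x, y) \<in> parcs (spined_cube n) \<longleftrightarrow>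
      (cube_to_gamma x, cube_to_gamma y) \<in> parcs (gamma_graph n)"
    if "length x = n" "length y = n" for x y
  proof -
    have "(x, y) \<in> parcs (spined_cube n) \<longleftrightarrow> (\<exists>i \<in> {1..n}. diff_set x y = spine x i)"
      using that spined_cube_arcs[of x y k] unfolding k by blast
    then show ?thesis
      unfolding spine_iff_conn_supports[OF assms that] gamma_arcs[OF assms that] .
  qed
  have "pair_graph (spined_cube n)" using pair_graph_spined_cube assms by simp
  note iso_iff = digraph_iso_iff_bij[OF this pair_graph_gamma_graph[OF assms]]
  show ?thesis
    unfolding iso_iff V W
    by (intro exI[of _ cube_to_gamma] conjI bij_betw_cube_to_gamma[OF assms])
      (use arcs in blast)
qed

end
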